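(* Let $\mathcal{A}$ be a regular Rickart *-ring and $b\in\mathcal{A}$. Then $[0,b]^{r*|\ell\square}$, $[0,b]^{r*|r\square}$ and $[0,b]^{r*|\square}$ are sublattices of the lattice $[0,b]^{r*}$. Moreover, $[0,b]^{r*|\square}$ is a sublattice of both $[0,b]^{r*|\ell\square}$ and $[0,b]^{r*|r\square}$.
   Context: A *-ring is an (associative) ring $\mathcal{A}$ with an involution $*$: $(a+b)^*=a^*+b^*$, $(ab)^*=b^*a^*$, $(a^* )^*=a$. It is a Rickart *-ring if for every $a\in\mathcal{A}$ there is a self-adjoint idempotent $p$ (i.e. $p=p^*=p^2$) with $\{x\in\mathcal{A}: xa=0\}=\mathcal{A}(1-p)$; such a ring has an identity $1$, and $p$ is unique and denoted $\mathrm{lp}(a)$. Likewise, for every $a$ there is a unique self-adjoint idempotent $\mathrm{rp}(a)$ with $\{x\in\mathcal{A}: ax=0\}=(1-\mathrm{rp}(a))\mathcal{A}$. The ring is regular if for every $a\in\mathcal{A}$ there is $a^-\in\mathcal{A}$ with $aa^-a=a$. Partial orders on $\mathcal{A}$: $a\preceq^{r*} b$ iff $a\,\mathrm{rp}(b)=a=b\,\mathrm{rp}(a)$ (right star order); $a\preceq^{r*|\ell\square} b$ iff $a\preceq^{r*}b$ and $a^2=ab$; $a\preceq^{r*|r\square} b$ iff $a\preceq^{r*}b$ and $a^2=ba$; $a\preceq^{r*|\square} b$ iff $a\preceq^{r*}b$ and $a^2=ab=ba$. For each such $\alpha$, $[0,b]^{\alpha}=\{a\in\mathcal{A}: a\preceq^{\alpha}b\}$,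 ordered by $\preceq^{\alpha}$. It is known that $[0,b]^{r*}$ is a lattice (order-isomorphic to the set of self-adjoint idempotents $p$ with $p=p\,\mathrm{rp}(b)$, ordered by $p\le q$ iff $p=pq$). A sublattice of a lattice $L$ is a nonempty subset closed under the operations $\vee$ and $\wedge$ of $L$. *)

theory Defs
  imports "HOL-Algebra.Ring" "HOL-Algebra.Lattice"
begin

section \<open>Rickart *-rings\<close>

record 'a star_ring = "'a ring" +
  star :: "'a \<Rightarrow> 'a" (\<open>_\<^sup>\<star>\<index>\<close> [1000] 999)

locale star_ring = ring A for A (structure) +
  assumes star_closed [intro, simp]: "a \<in> carrier A \<Longrightarrow> a\<^sup>\<star> \<in> carrier A"
    and star_add: "\<lbrakk>a \<in> carrier A; b \<in> carrier A\<rbrakk> \<Longrightarrow> (a \<oplus> b)\<^sup>\<star> = a\<^sup>\<star> \<oplus> b\<^sup>\<star>"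
    and star_mult: "\<lbrakk>a \<in> carrier A; b \<in> carrier A\<rbrakk> \<Longrightarrow> (a \<otimes> b)\<^sup>\<star> = b\<^sup>\<star> \<otimes> a\<^sup>\<star>"
    and star_star [simp]: "a \<in> carrier A \<Longrightarrow> (a\<^sup>\<star>)\<^sup>\<star> = a"

definition projection :: "('a, 'm) star_ring_scheme \<Rightarrow> 'a \<Rightarrow> bool"
  where "projection A p \<longleftrightarrow>
    p \<in> carrier A \<and> p\<^sup>\<star>\<^bsub>A\<^esub> = p \<and> p \<otimes>\<^bsub>A\<^esub> p = p"

locale rickart_star_ring = star_ring +
  assumes left_annihilator: "a \<in> carrier A \<Longrightarrow>
    \<exists>p. projection A p \<and>
      {x \<in> carrier A. x \<otimes> a = \<zero>} = {x \<otimes> (\<one> \<ominus> p) | x. x \<in> carrier A}"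

locale regular_rickart_star_ring = rickart_star_ring +
  assumes regular: "a \<in> carrier A \<Longrightarrow> \<exists>x \<in> carrier A. a \<otimes> x \<otimes> a = a"

definition rp :: "('a, 'm) star_ring_scheme \<Rightarrow> 'a \<Rightarrow> 'a" (\<open>rp\<index>\<close>)
  where "rp\<^bsub>A\<^esub> a = (THE p. projection A p \<and>
    {x \<in> carrier A. a \<otimes>\<^bsub>A\<^esub> x = \<zero>\<^bsub>A\<^esub>}
      = {(\<one>\<^bsub>A\<^esub> \<ominus>\<^bsub>A\<^esub> p) \<otimes>\<^bsub>A\<^esub> x | x. x \<in> carrier A})"

text \<open>The description in the definition of \<open>rp\<close> determines exactly one element.\<close>

context star_ring
begin

lemma star_minus:
  assumes "a \<in> carrier A" shows "(\<ominus> a)\<^sup>\<star> = \<ominus> (a\<^sup>\<star>)"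
proof -
  have z: "\<zero>\<^sup>\<star> = \<zero>"
  proof -
    have "\<zero>\<^sup>\<star> \<oplus> \<zero>\<^sup>\<star> = \<zero>\<^sup>\<star>"
      using star_add[of \<zero> \<zero>] by simp
    then show ?thesis using add.l_cancel_one'[of "\<zero>\<^sup>\<star>" "\<zero>\<^sup>\<star>"] by simp
  qed
  have "(\<ominus> a)\<^sup>\<star> \<oplus> a\<^sup>\<star> = \<zero>"
    using star_add[of "\<ominus> a" a] assms z by (simp add: l_neg)
  then show ?thesis
    using assms by (simp add: minus_equality)
qed

lemma star_one: "\<one>\<^sup>\<star> = \<one>"
  using star_mult[of "\<one>\<^sup>\<star>" \<one>] by simp

end

lemma (in rickart_star_ring) rp_ex1:
  assumes a: "a \<in> carrier A"
  shows "\<exists>!p. projection A p \<and>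
    {x \<in> carrier A. a \<otimes> x = \<zero>} = {(\<one> \<ominus> p) \<otimes> x | x. x \<in> carrier A}"
proof (rule ex_ex1I)
  obtain p where p: "projection A p"
    and eq: "{x \<in> carrier A. x \<otimes> a\<^sup>\<star> = \<zero>} = {x \<otimes> (\<one> \<ominus> p) | x. x \<in> carrier A}"
    using left_annihilator[of "a\<^sup>\<star>"] a by blast
  have pc: "p \<in> carrier A" "p\<^sup>\<star> = p" using p by (auto simp: projection_def)
  have q: "(\<one> \<ominus> p)\<^sup>\<star> = \<one> \<ominus> p"
    using pc by (simp add: a_minus_def star_add star_minus star_one)
  have z: "\<zero>\<^sup>\<star> = \<zero>"
    using star_add[of \<one> "\<ominus> \<one>"] by (simp add: star_minus star_one r_neg)
  have "{x \<in> carrier A. a \<otimes> x = \<zero>} = {(\<one> \<ominus> p) \<otimes> x | x. x \<in> carrier A}" (is "?L = ?R")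
  proof
    show "?L \<subseteq> ?R"
    proof
      fix x assume "x \<in> ?L"
      then have x: "x \<in> carrier A" "a \<otimes> x = \<zero>" by auto
      have "x\<^sup>\<star> \<otimes> a\<^sup>\<star> = \<zero>" using star_mult[of a x] a x z by simp
      then have "x\<^sup>\<star> \<in> {x \<in> carrier A. x \<otimes> a\<^sup>\<star> = \<zero>}" using x by simp
      then obtain y where y: "y \<in> carrier A" "x\<^sup>\<star> = y \<otimes> (\<one> \<ominus> p)" unfolding eq by blast
      have "x = (\<one> \<ominus> p) \<otimes> y\<^sup>\<star>"
        using star_mult[of y "\<one> \<ominus> p"] star_star[OF x(1)] y pc q by simp
      then show "x \<in> ?R" using y by blast
    qed
    show "?R \<subseteq> ?L"
    proof
      fix x assume "x \<in> ?R"
      then obtain y where y: "y \<in> carrier A" "x = (\<one> \<ominus> p) \<otimes> y" by blast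
      have x: "x \<in> carrier A" using y pc by simp
      have "x\<^sup>\<star> = y\<^sup>\<star> \<otimes> (\<one> \<ominus> p)" using y pc q star_mult[of "\<one> \<ominus> p" y] by simp
      then have "x\<^sup>\<star> \<in> {x \<in> carrier A. x \<otimes> a\<^sup>\<star> = \<zero>}" unfolding eq using y by blast
      then have "x\<^sup>\<star> \<otimes> a\<^sup>\<star> = \<zero>" by simp
      then have "(x\<^sup>\<star> \<otimes> a\<^sup>\<star>)\<^sup>\<star> = \<zero>" using z by simp
      then have "a \<otimes> x = \<zero>" using a x star_mult[of "x\<^sup>\<star>" "a\<^sup>\<star>"] by simp
      then show "x \<in> ?L" using x by simp
    qed
  qed
  then show "\<exists>p. projection A p \<and> ?L = {(\<one> \<ominus> p) \<otimes> x | x. x \<in> carrier A}" using p by blast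
next
  have le: "q \<otimes> p = q"
    if pq: "projection A p" "projection A q"
      and e: "{(\<one> \<ominus> p) \<otimes> x | x. x \<in> carrier A} = {(\<one> \<ominus> q) \<otimes> x | x. x \<in> carrier A}" for p q
  proof -
    have c: "p \<in> carrier A" "q \<in> carrier A" "q \<otimes> q = q" using pq by (auto simp: projection_def)
    have "(\<one> \<ominus> p) \<otimes> \<one> \<in> {(\<one> \<ominus> q) \<otimes> x | x. x \<in> carrier A}" unfolding e[symmetric] by blast
    then obtain x where x: "x \<in> carrier A" "\<one> \<ominus> p = (\<one> \<ominus> q) \<otimes> x" using c by auto
    have "q \<otimes> (\<one> \<ominus> p) = (q \<otimes> (\<one> \<ominus> q)) \<otimes> x" using x c by (simp add: m_assoc)
    also have "q \<otimes> (\<one> \<ominus> q) = \<zero>" using c by (simp add: a_minus_def r_distr r_minus r_neg)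
    finally have "q \<oplus> \<ominus> (q \<otimes> p) = \<zero>" using x c by (simp add: a_minus_def r_distr r_minus)
    then show ?thesis using c by (metis add.inv_closed add.inv_equality add.inv_inv m_closed)
  qed
  fix p q
  assume P: "projection A p \<and> {x \<in> carrier A. a \<otimes> x = \<zero>} = {(\<one> \<ominus> p) \<otimes> x | x. x \<in> carrier A}"
    and Q: "projection A q \<and> {x \<in> carrier A. a \<otimes> x = \<zero>} = {(\<one> \<ominus> q) \<otimes> x | x. x \<in> carrier A}"
  have "q \<otimes> p = q" "p \<otimes> q = p" using le[of p q] le[of q p] P Q by auto
  then show "p = q" using P Q star_mult[of q p] by (auto simp: projection_def)
qed

section \<open>Orders and initial intervals\<close>

definition right_star_le :: "('a, 'm) star_ring_scheme \<Rightarrow> 'a \<Rightarrow> 'a \<Rightarrow> bool"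
  where "right_star_le A a b \<longleftrightarrow> a \<otimes>\<^bsub>A\<^esub> rp\<^bsub>A\<^esub> b = a \<and> a = b \<otimes>\<^bsub>A\<^esub> rp\<^bsub>A\<^esub> a"

definition right_star_lsquare_le :: "('a, 'm) star_ring_scheme \<Rightarrow> 'a \<Rightarrow> 'a \<Rightarrow> bool"
  where "right_star_lsquare_le A a b \<longleftrightarrow>
    right_star_le A a b \<and> a \<otimes>\<^bsub>A\<^esub> a = a \<otimes>\<^bsub>A\<^esub> b"

definition right_star_rsquare_le :: "('a, 'm) star_ring_scheme \<Rightarrow> 'a \<Rightarrow> 'a \<Rightarrow> bool"
  where "right_star_rsquare_le A a b \<longleftrightarrow>
    right_star_le A a b \<and> a \<otimes>\<^bsub>A\<^esub> a = b \<otimes>\<^bsub>A\<^esub> a"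

definition right_star_square_le :: "('a, 'm) star_ring_scheme \<Rightarrow> 'a \<Rightarrow> 'a \<Rightarrow> bool"
  where "right_star_square_le A a b \<longleftrightarrow>
    right_star_le A a b \<and> a \<otimes>\<^bsub>A\<^esub> a = a \<otimes>\<^bsub>A\<^esub> b \<and> a \<otimes>\<^bsub>A\<^esub> b = b \<otimes>\<^bsub>A\<^esub> a"

definition initial_interval ::
    "('a, 'm) star_ring_scheme \<Rightarrow> (('a, 'm) star_ring_scheme \<Rightarrow> 'a \<Rightarrow> 'a \<Rightarrow> bool) \<Rightarrow> 'a \<Rightarrow> 'a gorder"
  where "initial_interval A r b =
    \<lparr>carrier = {a \<in> carrier A. r A a b}, eq = (=), le = r A\<rparr>"

section \<open>Sublattices\<close>

text \<open>A sublattice is a subset of the carrier of a lattice \<open>L\<close>; joins and meets are those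
  of \<open>L\<close>. In particular, the predicate asserts that \<open>L\<close> is a lattice for its own order.\<close>

locale sublattice = lattice L for H and L (structure) +
  assumes subset: "H \<subseteq> carrier L"
    and nonempty: "H \<noteq> {}"
    and join_in: "\<lbrakk>x \<in> H; y \<in> H\<rbrakk> \<Longrightarrow> x \<squnion> y \<in> H"
    and meet_in: "\<lbrakk>x \<in> H; y \<in> H\<rbrakk> \<Longrightarrow> x \<sqinter> y \<in> H"

end

theory Submission
  imports Defs
begin

text \<open>The map \<open>p \<mapsto> b \<otimes> p\<close> identifies the projections below \<open>rp b\<close> with the interval
  \<open>[0,b]\<close> of the right star order. Under it, \<open>a\<^sup>2 = ab\<close> becomes \<open>pbp = pb\<close>, and \<open>a\<^sup>2 = ba\<close> becomes
  \<open>pcp = pc\<close> for \<open>c = (rp b \<otimes> b)\<^sup>\<star>\<close>. So each of the four intervals consists of the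
  projections \<open>p\<close> whose left ideal \<open>\<A>p\<close> is stable under right multiplication by the elements of
  some set, and on each of them the order is the order of projections. By regularity, the join
  and the meet of projections correspond to the sum and the intersection of left ideals, and
  both preserve stability.\<close>

section \<open>Projections of a regular Rickart *-ring\<close>

context star_ring
begin

lemma projectionD:
  assumes "projection A p"
  shows "p \<in> carrier A" "p\<^sup>\<star> = p" "p \<otimes> p = p"
  using assms by (auto simp: projection_def)

lemma star_zero: "\<zero>\<^sup>\<star> = \<zero>"
  using star_add[of \<one> "\<ominus> \<one>"] by (simp add: star_minus star_one r_neg)

lemma minus_eq_zero_iff:
  assumes "a \<in> carrier A" "b \<in> carrier A"
  shows "a \<ominus> b = \<zero> \<longleftrightarrow> a = b"
proof
  assume "a \<ominus> b = \<zero>"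
  then have "\<ominus> (\<ominus> b) = a"
    using assms by (intro minus_equality) (simp_all add: a_minus_def)
  then show "a = b"
    using assms by simp
qed (use assms in \<open>simp add: a_minus_def r_neg\<close>)

lemma projection_zero: "projection A \<zero>"
  by (simp add: projection_def star_zero)

lemma projection_complement:
  assumes "projection A p" shows "projection A (\<one> \<ominus> p)"
proof -
  note p = projectionD[OF assms]
  have "(\<one> \<ominus> p) \<otimes> (\<one> \<ominus> p) = \<one> \<ominus> p \<ominus> p \<oplus> p \<otimes> p"
    using p(1) by algebra simp
  also have "\<dots> = \<one> \<ominus> p"
    unfolding p(3) using p(1) by algebra
  finally show ?thesis
    using p by (simp add: projection_def a_minus_def star_add star_minus star_one)
qed

lemma projection_add:
  assumes p: "projection A p" and q: "projection A q" and pq: "p \<otimes> q = \<zero>"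
  shows "projection A (p \<oplus> q)"
proof -
  note pD = projectionD[OF p] and qD = projectionD[OF q]
  have "q \<otimes> p = \<zero>"
    using star_mult[of p q] pD qD pq by (simp add: star_zero)
  then have "(p \<oplus> q) \<otimes> (p \<oplus> q) = p \<oplus> q"
    using pD qD pq by (simp add: l_distr r_distr)
  then show ?thesis
    using pD qD by (simp add: projection_def star_add)
qed

lemma projection_le_sym:
  assumes "projection A p" "projection A q"
  shows "p \<otimes> q = p \<longleftrightarrow> q \<otimes> p = p"
  using projectionD[OF assms(1)] projectionD[OF assms(2)] star_mult[of p q] star_mult[of q p]
  by auto

lemma mult_complement_eq_zero:
  assumes "x \<in> carrier A" "p \<in> carrier A"
  shows "x \<otimes> (\<one> \<ominus> p) = \<zero> \<longleftrightarrow> x \<otimes> p = x"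
proof -
  have "x \<otimes> (\<one> \<ominus> p) = x \<ominus> x \<otimes> p"
    using assms by algebra simp
  then show ?thesis
    using assms minus_eq_zero_iff[of x "x \<otimes> p"] by auto
qed

text \<open>Complementation reverses the order of projections; this is what later turns joins into
  meets.\<close>

lemma complement_le_complement:
  assumes p: "projection A p" and q: "projection A q"
  shows "(\<one> \<ominus> p) \<otimes> (\<one> \<ominus> q) = \<one> \<ominus> p \<longleftrightarrow> q \<otimes> p = q"
proof -
  note pc = projectionD(1)[OF p] and qc = projectionD(1)[OF q]
  have "\<one> \<ominus> (\<one> \<ominus> q) = q"
    using qc by algebra
  moreover have "(\<one> \<ominus> p) \<otimes> q = q \<ominus> p \<otimes> q"
    using pc qc by algebra
  ultimately have "(\<one> \<ominus> p) \<otimes> (\<one> \<ominus> q) = \<one> \<ominus> p \<longleftrightarrow> q \<ominus> p \<otimes> q = \<zero>"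
    using mult_complement_eq_zero[of "\<one> \<ominus> p" "\<one> \<ominus> q"] pc qc by simp
  also have "\<dots> \<longleftrightarrow> p \<otimes> q = q"
    using pc qc minus_eq_zero_iff[of q "p \<otimes> q"] by auto
  also have "\<dots> \<longleftrightarrow> q \<otimes> p = q"
    using projection_le_sym[OF q p] by simp
  finally show ?thesis .
qed

end

section \<open>Right projections and left cancellation\<close>

context rickart_star_ring
begin

lemma
  assumes a: "a \<in> carrier A"
  shows projection_rp: "projection A (rp a)"
    and right_annihilator: "{x \<in> carrier A. a \<otimes> x = \<zero>} = {(\<one> \<ominus> rp a) \<otimes> x | x. x \<in> carrier A}"
  using theI'[OF rp_ex1[OF a]] unfolding rp_def by auto

text \<open>Since \<open>rp a\<close> is idempotent, its right annihilator is generated by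
  \<open>\<one> \<ominus> rp a\<close>, just like that of \<open>a\<close>.\<close>

lemma rp_cancel_zero:
  assumes a: "a \<in> carrier A" and x: "x \<in> carrier A"
  shows "a \<otimes> x = \<zero> \<longleftrightarrow> rp a \<otimes> x = \<zero>"
proof
  note p = projectionD[OF projection_rp[OF a]]
  assume "a \<otimes> x = \<zero>"
  then obtain y where y: "y \<in> carrier A" "x = (\<one> \<ominus> rp a) \<otimes> y"
    using right_annihilator[OF a] x by blast
  have "rp a \<otimes> (\<one> \<ominus> rp a) = \<zero>"
    using p by (simp add: mult_complement_eq_zero)
  then show "rp a \<otimes> x = \<zero>"
    using y p by (simp add: m_assoc[symmetric])
next
  note p = projectionD[OF projection_rp[OF a]]
  assume *: "rp a \<otimes> x = \<zero>"
  have "(\<one> \<ominus> rp a) \<otimes> x = x \<ominus> rp a \<otimes> x"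
    using p(1) x by algebra
  then have "x = (\<one> \<ominus> rp a) \<otimes> x"
    using * x by (simp add: a_minus_def)
  then show "a \<otimes> x = \<zero>"
    using right_annihilator[OF a] x by blast
qed

text \<open>Applied to differences, equality of the annihilators lets a leading factor
  \<open>a\<close> be traded for \<open>rp a\<close>. This is the main device for removing
  \<open>b\<close> from the left of an equation.\<close>

lemma rp_cancel:
  assumes a: "a \<in> carrier A" and x: "x \<in> carrier A" and y: "y \<in> carrier A"
  shows "a \<otimes> x = a \<otimes> y \<longleftrightarrow> rp a \<otimes> x = rp a \<otimes> y"
proof -
  have p: "rp a \<in> carrier A"
    using projection_rp[OF a] by (rule projectionD)
  have *: "c \<otimes> x = c \<otimes> y \<longleftrightarrow> c \<otimes> (x \<ominus> y) = \<zero>" if c: "c \<in> carrier A" for c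
  proof -
    have "c \<otimes> (x \<ominus> y) = c \<otimes> x \<ominus> c \<otimes> y"
      using c x y by algebra
    then show ?thesis
      using minus_eq_zero_iff[of "c \<otimes> x" "c \<otimes> y"] c x y by simp
  qed
  show ?thesis
    using *[OF a] *[OF p] rp_cancel_zero[of a "x \<ominus> y"] a x y by simp
qed

lemma mult_rp:
  assumes "a \<in> carrier A" shows "a \<otimes> rp a = a"
  using rp_cancel[of a "rp a" \<one>] assms projectionD[OF projection_rp[OF assms]] by simp

text \<open>Cancelling against \<open>\<one>\<close> gives both \<open>p \<otimes> rp a = p\<close>
  and \<open>rp a \<otimes> p = rp a\<close>, so the two projections lie below each other.\<close>

lemma rp_unique:
  assumes a: "a \<in> carrier A" and p: "projection A p"
    and cancel: "\<And>x y. \<lbrakk>x \<in> carrier A; y \<in> carrier A\<rbrakk> \<Longrightarrow> a \<otimes> x = a \<otimes> y \<longleftrightarrow> p \<otimes> x = p \<otimes> y"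
  shows "rp a = p"
proof -
  note pD = projectionD[OF p] and rD = projectionD[OF projection_rp[OF a]]
  have "p \<otimes> rp a = p"
    using cancel[of "rp a" \<one>] a pD rD by (simp add: mult_rp)
  moreover have "rp a \<otimes> p = rp a"
    using rp_cancel[OF a, of p \<one>] cancel[of p \<one>] a pD rD by simp
  ultimately show ?thesis
    using projection_le_sym[OF p projection_rp[OF a]] by simp
qed

text \<open>Below \<open>rp b\<close> nothing is lost on multiplying by \<open>b\<close>, because
  \<open>rp b\<close> fixes \<open>p\<close> from the left. Hence \<open>rp\<close> inverts the map
  from \<open>p\<close> to \<open>b \<otimes> p\<close>, which is therefore injective there.\<close>

lemma rp_mult_projection:
  assumes b: "b \<in> carrier A" and p: "projection A p" and le: "p \<otimes> rp b = p"
  shows "rp (b \<otimes> p) = p"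
proof (rule rp_unique[OF _ p])
  note pD = projectionD[OF p] and eD = projectionD[OF projection_rp[OF b]]
  show "b \<otimes> p \<in> carrier A"
    using b pD by simp
  fix x y assume x: "x \<in> carrier A" and y: "y \<in> carrier A"
  have "rp b \<otimes> p = p"
    using le projection_le_sym[OF p projection_rp[OF b]] by simp
  then have "rp b \<otimes> (p \<otimes> z) = p \<otimes> z" if "z \<in> carrier A" for z
    using that pD eD by (simp add: m_assoc[symmetric])
  then show "b \<otimes> p \<otimes> x = b \<otimes> p \<otimes> y \<longleftrightarrow> p \<otimes> x = p \<otimes> y"
    using rp_cancel[OF b, of "p \<otimes> x" "p \<otimes> y"] b pD x y by (simp add: m_assoc)
qed

end

section \<open>Joins and meets of projections under regularity\<close>

context regular_rickart_star_ring
begin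

text \<open>The last property of the join \<open>r\<close> is a first-order rendering of \<open>\<A>r = \<A>p + \<A>q\<close>, that of
  the meet \<open>t\<close> below of \<open>\<A>t = \<A>p \<inter> \<A>q\<close>.\<close>

lemma projection_join:
  assumes p: "projection A p" and q: "projection A q"
  obtains r where "projection A r" "p \<otimes> r = p" "q \<otimes> r = q"
    "\<And>u v. \<lbrakk>u \<in> carrier A; v \<in> carrier A; p \<otimes> u = p \<otimes> v; q \<otimes> u = q \<otimes> v\<rbrakk> \<Longrightarrow> r \<otimes> u = r \<otimes> v"
proof -
  note pD = projectionD[OF p] and qD = projectionD[OF q]
  \<comment> \<open>\<open>c\<close> is the part of \<open>q\<close> that \<open>p\<close> does not
    cover. Its right projection \<open>f\<close> is orthogonal to \<open>p\<close>, and the join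
    will be \<open>p \<oplus> f\<close>.\<close>
  define c where "c = q \<otimes> (\<one> \<ominus> p)"
  define f where "f = rp c"
  have c: "c \<in> carrier A"
    using pD qD by (simp add: c_def)
  have f: "projection A f"
    unfolding f_def by (rule projection_rp[OF c])
  note fD = projectionD[OF f]
  have c_eq: "c = q \<ominus> q \<otimes> p"
    unfolding c_def using pD(1) qD(1) by algebra simp
  have "(\<one> \<ominus> p) \<otimes> p = p \<ominus> p \<otimes> p"
    using pD(1) by algebra
  then have "(\<one> \<ominus> p) \<otimes> p = \<zero>"
    using pD by (simp add: a_minus_def r_neg)
  then have "c \<otimes> p = \<zero>"
    using pD qD by (simp add: c_def m_assoc)
  then have fp: "f \<otimes> p = \<zero>"
    using rp_cancel_zero[OF c pD(1)] by (simp add: f_def)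
  then have pf: "p \<otimes> f = \<zero>"
    using star_mult[of f p] pD fD by (simp add: star_zero)
  \<comment> \<open>Regularity enters here: cancelling \<open>c\<close> in \<open>c x c = c\<close>
    yields \<open>f = f x c\<close>. So \<open>f\<close> is a left multiple of \<open>c\<close>,
    hence lies in the sum of the left ideals of \<open>p\<close> and \<open>q\<close>.\<close>
  obtain x where x: "x \<in> carrier A" "c \<otimes> x \<otimes> c = c"
    using regular[OF c] by blast
  have f_eq: "f = f \<otimes> (x \<otimes> c)"
    using rp_cancel[OF c, of "x \<otimes> c" \<one>] x c fD by (simp add: f_def m_assoc)
  have "f \<otimes> (x \<otimes> c) = f \<otimes> x \<otimes> q \<ominus> f \<otimes> x \<otimes> q \<otimes> p"
    unfolding c_eq using pD(1) qD(1) fD(1) x(1) by algebra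
  with f_eq have f_eq': "f = f \<otimes> x \<otimes> q \<ominus> f \<otimes> x \<otimes> q \<otimes> p"
    by (rule trans)
  show thesis
  proof (rule that[of "p \<oplus> f"])
    show "projection A (p \<oplus> f)"
      by (rule projection_add[OF p f pf])
    show "p \<otimes> (p \<oplus> f) = p"
      using pD fD pf by (simp add: r_distr)
    \<comment> \<open>The left side is \<open>c\<close> because \<open>f = rp c\<close>, and
      \<open>p \<otimes> f\<close> vanishes, so this evaluates \<open>q \<otimes> f\<close>.\<close>
    have "c \<otimes> f = q \<otimes> f \<ominus> q \<otimes> (p \<otimes> f)"
      unfolding c_eq using pD(1) qD(1) fD(1) by algebra
    then have "q \<otimes> f = q \<ominus> q \<otimes> p"
      using mult_rp[OF c] c_eq pf qD fD by (simp add: f_def a_minus_def)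
    then have "q \<otimes> (p \<oplus> f) = q \<otimes> p \<oplus> (q \<ominus> q \<otimes> p)"
      using pD qD fD by (simp add: r_distr)
    also have "\<dots> = q"
      using pD(1) qD(1) by algebra
    finally show "q \<otimes> (p \<oplus> f) = q" .
    fix u v assume u: "u \<in> carrier A" and v: "v \<in> carrier A"
      and pu: "p \<otimes> u = p \<otimes> v" and qu: "q \<otimes> u = q \<otimes> v"
    \<comment> \<open>The formula for \<open>f\<close> shows that \<open>f \<otimes> w\<close>
      depends on \<open>w\<close> only through \<open>p \<otimes> w\<close> and
      \<open>q \<otimes> w\<close>.\<close>
    have *: "f \<otimes> w = f \<otimes> x \<otimes> (q \<otimes> w) \<ominus> f \<otimes> x \<otimes> q \<otimes> (p \<otimes> w)" if w: "w \<in> carrier A" for w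
    proof -
      have "f \<otimes> w = (f \<otimes> x \<otimes> q \<ominus> f \<otimes> x \<otimes> q \<otimes> p) \<otimes> w"
        by (rule arg_cong[OF f_eq'])
      also have "\<dots> = f \<otimes> x \<otimes> (q \<otimes> w) \<ominus> f \<otimes> x \<otimes> q \<otimes> (p \<otimes> w)"
        using pD(1) qD(1) fD(1) x(1) w by algebra
      finally show ?thesis .
    qed
    have "f \<otimes> u = f \<otimes> v"
      unfolding *[OF u] *[OF v] pu qu ..
    then show "(p \<oplus> f) \<otimes> u = (p \<oplus> f) \<otimes> v"
      using pu pD fD u v by (simp add: l_distr)
  qed
qed

lemma projection_meet:
  assumes p: "projection A p" and q: "projection A q"
  obtains t where "projection A t" "t \<otimes> p = t" "t \<otimes> q = t"
    "\<And>x. \<lbrakk>x \<in> carrier A; x \<otimes> p = x; x \<otimes> q = x\<rbrakk> \<Longrightarrow> x \<otimes> t = x"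
proof -
  note p' = projection_complement[OF p] and q' = projection_complement[OF q]
  note pD = projectionD[OF p] and qD = projectionD[OF q]
  note p'D = projectionD[OF p'] and q'D = projectionD[OF q']
  obtain r where r: "projection A r" "(\<one> \<ominus> p) \<otimes> r = \<one> \<ominus> p" "(\<one> \<ominus> q) \<otimes> r = \<one> \<ominus> q"
    and det: "\<And>u v. \<lbrakk>u \<in> carrier A; v \<in> carrier A; (\<one> \<ominus> p) \<otimes> u = (\<one> \<ominus> p) \<otimes> v;
      (\<one> \<ominus> q) \<otimes> u = (\<one> \<ominus> q) \<otimes> v\<rbrakk> \<Longrightarrow> r \<otimes> u = r \<otimes> v"
    using projection_join[OF p' q'] by metis
  note rD = projectionD[OF r(1)]
  \<comment> \<open>By De Morgan, the meet is the complement of the join \<open>r\<close> of the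
    complements.\<close>
  define t where "t = \<one> \<ominus> r"
  have t: "projection A t"
    unfolding t_def by (rule projection_complement[OF r(1)])
  note tD = projectionD[OF t]
  have r_eq: "r = \<one> \<ominus> t"
    unfolding t_def using rD(1) by algebra
  show thesis
  proof (rule that[OF t])
    show "t \<otimes> p = t" "t \<otimes> q = t"
      using r complement_le_complement[OF p t] complement_le_complement[OF q t]
      by (simp_all add: r_eq)
    fix x assume x: "x \<in> carrier A" and xp: "x \<otimes> p = x" and xq: "x \<otimes> q = x"
    \<comment> \<open>The join controls left multiplication by \<open>r\<close>, whereas
      \<open>x\<close> is multiplied on the right; the star exchanges the two sides.\<close>
    have *: "(\<one> \<ominus> s) \<otimes> x\<^sup>\<star> = \<zero>" if s: "projection A s" and xs: "x \<otimes> s = x" for s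
      using star_mult[of x "\<one> \<ominus> s"] mult_complement_eq_zero[OF x, of s] xs x
        projectionD[OF s] projectionD[OF projection_complement[OF s]] by (simp add: star_zero)
    have "r \<otimes> x\<^sup>\<star> = r \<otimes> \<zero>"
      using det[of "x\<^sup>\<star>" \<zero>] *[OF p xp] *[OF q xq] x p'D q'D by simp
    then have "x \<otimes> r = \<zero>"
      using star_mult[of r "x\<^sup>\<star>"] x rD by (simp add: star_zero)
    then show "x \<otimes> t = x"
      using mult_complement_eq_zero[OF x, of t] tD by (simp add: r_eq)
  qed
qed

end

section \<open>Stable projections\<close>

text \<open>The equation for \<open>c\<close> says that \<open>p c\<close> stays in the left ideal
  generated by \<open>p\<close>. In use \<open>e\<close> is \<open>rp b\<close>, and the set
  \<open>C\<close> tells the intervals apart: it is empty for the right star order and grows with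
  the square conditions imposed.\<close>

definition stable_projections :: "('a, 'm) star_ring_scheme \<Rightarrow> 'a \<Rightarrow> 'a set \<Rightarrow> 'a set"
  where "stable_projections A e C = {p. projection A p \<and> p \<otimes>\<^bsub>A\<^esub> e = p \<and>
    (\<forall>c\<in>C. p \<otimes>\<^bsub>A\<^esub> c \<otimes>\<^bsub>A\<^esub> p = p \<otimes>\<^bsub>A\<^esub> c)}"

context regular_rickart_star_ring
begin

lemma zero_stable:
  assumes "e \<in> carrier A" "C \<subseteq> carrier A"
  shows "\<zero> \<in> stable_projections A e C"
  using assms projection_zero by (auto simp: stable_projections_def)

text \<open>The join does not depend on \<open>C\<close>, so that it serves for all the intervals at once.\<close>

lemma stable_join:
  assumes e: "projection A e"
    and p: "p \<in> stable_projections A e {}" and q: "q \<in> stable_projections A e {}"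
  obtains r where
    "\<And>C. \<lbrakk>C \<subseteq> carrier A; p \<in> stable_projections A e C; q \<in> stable_projections A e C\<rbrakk>
      \<Longrightarrow> r \<in> stable_projections A e C"
    "p \<otimes> r = p" "q \<otimes> r = q"
    "\<And>s. \<lbrakk>s \<in> carrier A; p \<otimes> s = p; q \<otimes> s = q\<rbrakk> \<Longrightarrow> r \<otimes> s = r"
proof -
  have P: "projection A p" "p \<otimes> e = p" and Q: "projection A q" "q \<otimes> e = q"
    using p q by (auto simp: stable_projections_def)
  note pD = projectionD[OF P(1)] and qD = projectionD[OF Q(1)] and eD = projectionD[OF e]
  obtain r where r: "projection A r" "p \<otimes> r = p" "q \<otimes> r = q"
    and det: "\<And>u v. \<lbrakk>u \<in> carrier A; v \<in> carrier A; p \<otimes> u = p \<otimes> v; q \<otimes> u = q \<otimes> v\<rbrakk>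
      \<Longrightarrow> r \<otimes> u = r \<otimes> v"
    using projection_join[OF P(1) Q(1)] by metis
  note rD = projectionD[OF r(1)]
  have least: "r \<otimes> s = r" if "s \<in> carrier A" "p \<otimes> s = p" "q \<otimes> s = q" for s
    using det[of s \<one>] that pD qD rD by simp
  have stable: "r \<in> stable_projections A e C"
    if C: "C \<subseteq> carrier A" "p \<in> stable_projections A e C" "q \<in> stable_projections A e C" for C
  proof -
    have "r \<otimes> c \<otimes> r = r \<otimes> c" if c: "c \<in> C" for c
    proof -
      have cA: "c \<in> carrier A"
        using c C by auto
      \<comment> \<open>By stability \<open>s c\<close> ends in a factor \<open>s\<close>, which
        absorbs \<open>r\<close>.\<close>
      have *: "s \<otimes> (c \<otimes> r) = s \<otimes> c"
        if s: "s \<in> stable_projections A e C" and sr: "s \<otimes> r = s" for s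
      proof -
        have sA: "s \<in> carrier A" and sc: "s \<otimes> c \<otimes> s = s \<otimes> c"
          using s c by (auto simp: stable_projections_def projection_def)
        have "s \<otimes> (c \<otimes> r) = s \<otimes> c \<otimes> s \<otimes> r"
          using sA cA rD(1) sc by (simp add: m_assoc)
        also have "\<dots> = s \<otimes> c \<otimes> (s \<otimes> r)"
          using sA cA rD(1) by (simp add: m_assoc)
        finally show ?thesis
          using sr sc by simp
      qed
      show ?thesis
        \<comment> \<open>\<open>c r\<close> and \<open>c\<close> agree after left multiplication by
          \<open>p\<close> and by \<open>q\<close>, hence also by \<open>r\<close>.\<close>
        using det[of "c \<otimes> r" c] *[OF C(2) r(2)] *[OF C(3) r(3)] cA rD by (simp add: m_assoc)
    qed
    then show ?thesis
      using r least[OF eD(1) P(2) Q(2)] by (auto simp: stable_projections_def)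
  qed
  show thesis
    by (rule that[OF stable r(2,3) least])
qed

text \<open>An intersection of stable left ideals is stable: \<open>t c\<close> is fixed by
  \<open>p\<close> and by \<open>q\<close> on the right, hence by \<open>t\<close>. As with the
  join, \<open>t\<close> is chosen before \<open>C\<close>.\<close>

lemma stable_meet:
  assumes p: "p \<in> stable_projections A e {}" and q: "q \<in> stable_projections A e {}"
    and e: "e \<in> carrier A"
  obtains t where
    "\<And>C. \<lbrakk>C \<subseteq> carrier A; p \<in> stable_projections A e C; q \<in> stable_projections A e C\<rbrakk>
      \<Longrightarrow> t \<in> stable_projections A e C"
    "t \<otimes> p = t" "t \<otimes> q = t"
    "\<And>s. \<lbrakk>s \<in> carrier A; s \<otimes> p = s; s \<otimes> q = s\<rbrakk> \<Longrightarrow> s \<otimes> t = s"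
proof -
  have P: "projection A p" "p \<otimes> e = p" and Q: "projection A q" "q \<otimes> e = q"
    using p q by (auto simp: stable_projections_def)
  note pD = projectionD[OF P(1)] and qD = projectionD[OF Q(1)]
  obtain t where t: "projection A t" "t \<otimes> p = t" "t \<otimes> q = t"
    and greatest: "\<And>x. \<lbrakk>x \<in> carrier A; x \<otimes> p = x; x \<otimes> q = x\<rbrakk> \<Longrightarrow> x \<otimes> t = x"
    using projection_meet[OF P(1) Q(1)] by metis
  note tD = projectionD[OF t(1)]
  have te: "t \<otimes> e = t"
    using m_assoc[of t p e] t(2) P(2) tD pD e by simp
  have stable: "t \<in> stable_projections A e C"
    if C: "C \<subseteq> carrier A" "p \<in> stable_projections A e C" "q \<in> stable_projections A e C" for C
  proof -
    have "t \<otimes> c \<otimes> t = t \<otimes> c" if c: "c \<in> C" for c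
    proof -
      have cA: "c \<in> carrier A"
        using c C by auto
      \<comment> \<open>Inserting \<open>s\<close> through \<open>t = t s\<close> makes the
        stability of \<open>s\<close> available.\<close>
      have *: "t \<otimes> c \<otimes> s = t \<otimes> c"
        if s: "s \<in> stable_projections A e C" and ts: "t \<otimes> s = t" for s
      proof -
        have sA: "s \<in> carrier A" and sc: "s \<otimes> c \<otimes> s = s \<otimes> c"
          using s c by (auto simp: stable_projections_def projection_def)
        have "t \<otimes> c \<otimes> s = t \<otimes> s \<otimes> c \<otimes> s"
          using ts by simp
        also have "\<dots> = t \<otimes> (s \<otimes> c \<otimes> s)"
          using sA cA tD(1) by (simp add: m_assoc)
        also have "\<dots> = t \<otimes> s \<otimes> c"
          using sA cA tD(1) sc by (simp add: m_assoc)
        finally show ?thesis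
          using ts by simp
      qed
      show ?thesis
        using greatest[of "t \<otimes> c"] *[OF C(2) t(2)] *[OF C(3) t(3)] cA tD by simp
    qed
    then show ?thesis
      using t te by (auto simp: stable_projections_def)
  qed
  show thesis
    by (rule that[OF stable t(2,3) greatest])
qed

end

section \<open>Intervals\<close>

text \<open>One witness serves both purposes: it provides the bound that makes \<open>L\<close> a
  lattice, and, bounds being unique in a partial order, it is the join or meet that must stay in
  \<open>H\<close>.\<close>

lemma sublatticeI:
  fixes L (structure)
  assumes "partial_order L" and "H \<subseteq> carrier L" and "H \<noteq> {}"
    and join: "\<And>x y. \<lbrakk>x \<in> carrier L; y \<in> carrier L\<rbrakk>
      \<Longrightarrow> \<exists>z. least L z (Upper L {x, y}) \<and> (x \<in> H \<longrightarrow> y \<in> H \<longrightarrow> z \<in> H)"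
    and meet: "\<And>x y. \<lbrakk>x \<in> carrier L; y \<in> carrier L\<rbrakk>
      \<Longrightarrow> \<exists>z. greatest L z (Lower L {x, y}) \<and> (x \<in> H \<longrightarrow> y \<in> H \<longrightarrow> z \<in> H)"
  shows "sublattice H L"
proof -
  interpret partial_order L by fact
  interpret lattice L
    by unfold_locales (use join meet in blast)+
  show ?thesis
  proof
    show "H \<subseteq> carrier L" "H \<noteq> {}" by fact+
    fix x y assume xy: "x \<in> H" "y \<in> H"
    then have c: "x \<in> carrier L" "y \<in> carrier L" using \<open>H \<subseteq> carrier L\<close> by auto
    obtain z where z: "least L z (Upper L {x, y})" "z \<in> H"
      using join[OF c] xy by auto
    show "x \<squnion> y \<in> H"
      by (rule joinI[OF _ c]) (use z least_unique in blast)
    obtain z where z: "greatest L z (Lower L {x, y})" "z \<in> H"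
      using meet[OF c] xy by auto
    show "x \<sqinter> y \<in> H"
      by (rule meetI[OF _ c]) (use z greatest_unique in blast)
  qed
qed

section \<open>Intervals as images of stable projections\<close>

context regular_rickart_star_ring
begin

text \<open>Common source of all five claims: \<open>D\<close> describes the ambient interval and
  the larger set \<open>C\<close> the smaller one. Bounds formed for \<open>D\<close> stay stable
  under \<open>C\<close>, since their choice depends on neither set.\<close>

lemma sublattice_image:
  fixes L :: "'a gorder"
  assumes b: "b \<in> carrier A" and C: "C \<subseteq> carrier A" and DC: "D \<subseteq> C"
    and car: "carrier L = (\<otimes>) b ` stable_projections A (rp b) D"
    and H: "H = (\<otimes>) b ` stable_projections A (rp b) C"
    and eq: "eq L = (=)"
    and le: "\<And>p q. \<lbrakk>p \<in> stable_projections A (rp b) D; q \<in> stable_projections A (rp b) D\<rbrakk>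
      \<Longrightarrow> le L (b \<otimes> p) (b \<otimes> q) \<longleftrightarrow> p \<otimes> q = p"
  shows "sublattice H L"
proof (rule sublatticeI)
  let ?S = "stable_projections A (rp b)"
  have e: "projection A (rp b)" "rp b \<in> carrier A"
    using projection_rp[OF b] by (auto dest: projectionD)
  have S0: "p \<in> ?S {}" if "p \<in> ?S X" for p X
    using that by (auto simp: stable_projections_def)
  have SA: "p \<in> carrier A" "projection A p" if "p \<in> ?S X" for p X
    using that by (auto simp: stable_projections_def projection_def)
  have SCD: "?S C \<subseteq> ?S D"
    using DC by (auto simp: stable_projections_def)
  have DA: "D \<subseteq> carrier A"
    using C DC by auto
  \<comment> \<open>Membership in the image reduces to membership of \<open>p\<close> itself, since
    \<open>rp\<close> recovers \<open>p\<close> from \<open>b \<otimes> p\<close>.\<close>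
  have mem: "b \<otimes> p \<in> H \<longleftrightarrow> p \<in> ?S C" if p: "p \<in> ?S D" for p
  proof
    assume "b \<otimes> p \<in> H"
    then obtain q where q: "q \<in> ?S C" "b \<otimes> p = b \<otimes> q"
      unfolding H by auto
    have rp_eq: "rp (b \<otimes> s) = s" if "s \<in> ?S X" for s X
      using that rp_mult_projection[OF b, of s] unfolding stable_projections_def by blast
    have "p = q"
      using rp_eq[OF p] rp_eq[OF q(1)] q(2) by metis
    then show "p \<in> ?S C"
      using q(1) by simp
  qed (auto simp: H)
  show "partial_order L"
  proof
    fix x y z assume xyz: "x \<in> carrier L" "y \<in> carrier L" "z \<in> carrier L"
    then obtain p q s where pqs: "p \<in> ?S D" "q \<in> ?S D" "s \<in> ?S D"
      and x: "x = b \<otimes> p" "y = b \<otimes> q" "z = b \<otimes> s"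
      unfolding car by auto
    show "le L x x"
      using le[OF pqs(1) pqs(1)] projectionD[OF SA(2)[OF pqs(1)]] by (simp add: x)
    show "eq L x y" if "le L x y" "le L y x"
    proof -
      have "p \<otimes> q = p" "q \<otimes> p = q"
        using that le pqs by (simp_all add: x)
      then show ?thesis
        using projection_le_sym[OF SA(2)[OF pqs(1)] SA(2)[OF pqs(2)]] by (simp add: x eq)
    qed
    show "le L x z" if "le L x y" "le L y z"
    proof -
      have "p \<otimes> q = p" "q \<otimes> s = q"
        using that le pqs by (simp_all add: x)
      then have "p \<otimes> s = p"
        using m_assoc[of p q s] SA(1) pqs by metis
      then show ?thesis
        using le[OF pqs(1,3)] by (simp add: x)
    qed
  qed (simp_all add: eq)
  show "H \<subseteq> carrier L"
    using SCD by (auto simp: car H)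
  show "H \<noteq> {}"
    using zero_stable[OF e(2) C] by (auto simp: H)
  fix x y assume "x \<in> carrier L" "y \<in> carrier L"
  then obtain p q where pq: "p \<in> ?S D" "q \<in> ?S D" and x: "x = b \<otimes> p" "y = b \<otimes> q"
    unfolding car by auto
  have inS: "{x, y} \<subseteq> carrier L"
    using pq by (auto simp: x car)
  obtain r where r: "\<And>C. \<lbrakk>C \<subseteq> carrier A; p \<in> ?S C; q \<in> ?S C\<rbrakk> \<Longrightarrow> r \<in> ?S C"
    "p \<otimes> r = p" "q \<otimes> r = q" "\<And>s. \<lbrakk>s \<in> carrier A; p \<otimes> s = p; q \<otimes> s = q\<rbrakk> \<Longrightarrow> r \<otimes> s = r"
    using stable_join[OF e(1) S0[OF pq(1)] S0[OF pq(2)]] by metis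
  have rD: "r \<in> ?S D"
    by (rule r(1)[OF DA pq])
  have "least L (b \<otimes> r) (Upper L {x, y})"
    using rD r(2-4) pq SA(1) inS by (auto simp: least_def Upper_def car x le)
  moreover have "x \<in> H \<longrightarrow> y \<in> H \<longrightarrow> b \<otimes> r \<in> H"
    using r(1)[OF C] mem[OF rD] mem[OF pq(1)] mem[OF pq(2)] by (simp add: x)
  ultimately show "\<exists>z. least L z (Upper L {x, y}) \<and> (x \<in> H \<longrightarrow> y \<in> H \<longrightarrow> z \<in> H)"
    by blast
  obtain t where t: "\<And>C. \<lbrakk>C \<subseteq> carrier A; p \<in> ?S C; q \<in> ?S C\<rbrakk> \<Longrightarrow> t \<in> ?S C"
    "t \<otimes> p = t" "t \<otimes> q = t" "\<And>s. \<lbrakk>s \<in> carrier A; s \<otimes> p = s; s \<otimes> q = s\<rbrakk> \<Longrightarrow> s \<otimes> t = s"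
    using stable_meet[OF S0[OF pq(1)] S0[OF pq(2)] e(2)] by metis
  have tD: "t \<in> ?S D"
    by (rule t(1)[OF DA pq])
  have "greatest L (b \<otimes> t) (Lower L {x, y})"
    using tD t(2-4) pq SA(1) inS by (auto simp: greatest_def Lower_def car x le)
  moreover have "x \<in> H \<longrightarrow> y \<in> H \<longrightarrow> b \<otimes> t \<in> H"
    using t(1)[OF C] mem[OF tD] mem[OF pq(1)] mem[OF pq(2)] by (simp add: x)
  ultimately show "\<exists>z. greatest L z (Lower L {x, y}) \<and> (x \<in> H \<longrightarrow> y \<in> H \<longrightarrow> z \<in> H)"
    by blast
qed

text \<open>The right projections of the two products are \<open>p\<close> and \<open>q\<close>, so
  the order amounts to \<open>b p q = b p\<close> and \<open>b p = b q p\<close>. Cancelling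
  \<open>b\<close> turns the first into \<open>p q = p\<close>, which implies the second by taking
  stars.\<close>

lemma right_star_le_mult:
  assumes b: "b \<in> carrier A"
    and p: "projection A p" "p \<otimes> rp b = p" and q: "projection A q" "q \<otimes> rp b = q"
  shows "right_star_le A (b \<otimes> p) (b \<otimes> q) \<longleftrightarrow> p \<otimes> q = p"
proof -
  note pD = projectionD[OF p(1)] and qD = projectionD[OF q(1)]
  have *: "rp b \<otimes> p = p"
    using p projection_le_sym[OF p(1) projection_rp[OF b]] by simp
  have "b \<otimes> p \<otimes> q = b \<otimes> p \<longleftrightarrow> rp b \<otimes> p \<otimes> q = rp b \<otimes> p"
    using rp_cancel[OF b, of "p \<otimes> q" p] b pD qD projectionD[OF projection_rp[OF b]]
    by (simp add: m_assoc)
  also have "\<dots> \<longleftrightarrow> p \<otimes> q = p"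
    by (simp add: *)
  finally have **: "b \<otimes> p \<otimes> q = b \<otimes> p \<longleftrightarrow> p \<otimes> q = p" .
  have "b \<otimes> p = b \<otimes> q \<otimes> p" if "p \<otimes> q = p"
    using that projection_le_sym[OF p(1) q(1)] b pD qD by (simp add: m_assoc)
  then show ?thesis
    using ** by (auto simp: right_star_le_def rp_mult_projection[OF b p] rp_mult_projection[OF b q])
qed

text \<open>An element \<open>a\<close> below \<open>b\<close> has the form
  \<open>b \<otimes> rp a\<close>, and cancelling \<open>a\<close> in
  \<open>a \<otimes> rp b = a\<close> puts \<open>rp a\<close> below \<open>rp b\<close>.\<close>

lemma right_star_interval:
  assumes b: "b \<in> carrier A"
  shows "{a \<in> carrier A. right_star_le A a b} = (\<otimes>) b ` stable_projections A (rp b) {}"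
proof (intro equalityI subsetI)
  fix a assume "a \<in> {a \<in> carrier A. right_star_le A a b}"
  then have a: "a \<in> carrier A" "a \<otimes> rp b = a" "a = b \<otimes> rp a"
    unfolding right_star_le_def by blast+
  have "rp a \<otimes> rp b = rp a"
    using rp_cancel[OF a(1), of "rp b" \<one>] a(1,2) projectionD[OF projection_rp[OF b]]
      projectionD[OF projection_rp[OF a(1)]] by simp
  then show "a \<in> (\<otimes>) b ` stable_projections A (rp b) {}"
    using a(3) projection_rp[OF a(1)] unfolding stable_projections_def by blast
next
  fix a assume "a \<in> (\<otimes>) b ` stable_projections A (rp b) {}"
  then obtain p where p: "projection A p" "p \<otimes> rp b = p" "a = b \<otimes> p"
    by (auto simp: stable_projections_def)
  then show "a \<in> {a \<in> carrier A. right_star_le A a b}"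
    using b projectionD[OF p(1)] projectionD[OF projection_rp[OF b]] rp_mult_projection[OF b p(1,2)]
    by (auto simp: right_star_le_def m_assoc)
qed

text \<open>With \<open>a = b p\<close>, this is \<open>a a = a b\<close> after cancelling the
  leading \<open>b\<close>; \<open>rp b\<close> then disappears into \<open>p\<close>.\<close>

lemma square_eq_mult_right:
  assumes b: "b \<in> carrier A" and p: "projection A p" "p \<otimes> rp b = p"
  shows "b \<otimes> p \<otimes> (b \<otimes> p) = b \<otimes> p \<otimes> b \<longleftrightarrow> p \<otimes> b \<otimes> p = p \<otimes> b"
proof -
  note pD = projectionD[OF p(1)] and eD = projectionD[OF projection_rp[OF b]]
  have *: "rp b \<otimes> p = p"
    using p projection_le_sym[OF p(1) projection_rp[OF b]] by simp
  have "b \<otimes> p \<otimes> (b \<otimes> p) = b \<otimes> p \<otimes> b \<longleftrightarrow> rp b \<otimes> p \<otimes> (b \<otimes> p) = rp b \<otimes> p \<otimes> b"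
    using rp_cancel[OF b, of "p \<otimes> (b \<otimes> p)" "p \<otimes> b"] b pD eD by (simp add: m_assoc)
  then show ?thesis
    using b pD by (simp add: * m_assoc)
qed

text \<open>The same cancellation for \<open>a a = b a\<close>, but on the right \<open>rp b\<close>
  meets \<open>b\<close> rather than \<open>p\<close> and therefore remains.\<close>

lemma square_eq_mult_left:
  assumes b: "b \<in> carrier A" and p: "projection A p" "p \<otimes> rp b = p"
  shows "b \<otimes> p \<otimes> (b \<otimes> p) = b \<otimes> (b \<otimes> p) \<longleftrightarrow> p \<otimes> b \<otimes> p = rp b \<otimes> b \<otimes> p"
proof -
  note pD = projectionD[OF p(1)] and eD = projectionD[OF projection_rp[OF b]]
  have *: "rp b \<otimes> p = p"
    using p projection_le_sym[OF p(1) projection_rp[OF b]] by simp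
  have "b \<otimes> p \<otimes> (b \<otimes> p) = b \<otimes> (b \<otimes> p) \<longleftrightarrow> rp b \<otimes> p \<otimes> (b \<otimes> p) = rp b \<otimes> (b \<otimes> p)"
    using rp_cancel[OF b, of "p \<otimes> (b \<otimes> p)" "b \<otimes> p"] b pD eD by (simp add: m_assoc)
  then show ?thesis
    using b pD eD by (simp add: * m_assoc)
qed

text \<open>With \<open>c = rp b \<otimes> b\<close> one has \<open>p c = p b\<close>, so the
  right-hand condition reads \<open>p c p = c p\<close>. Its star is stability under the star of
  \<open>c\<close>, which brings the second square condition into the form used for the
  first.\<close>

lemma star_stable_iff:
  assumes b: "b \<in> carrier A" and p: "projection A p" "p \<otimes> rp b = p"
  shows "p \<otimes> (rp b \<otimes> b)\<^sup>\<star> \<otimes> p = p \<otimes> (rp b \<otimes> b)\<^sup>\<star> \<longleftrightarrow> p \<otimes> b \<otimes> p = rp b \<otimes> b \<otimes> p"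
proof -
  note pD = projectionD[OF p(1)] and eD = projectionD[OF projection_rp[OF b]]
  define c where "c = rp b \<otimes> b"
  have c: "c \<in> carrier A"
    using b eD by (simp add: c_def)
  have "p \<otimes> c\<^sup>\<star> \<otimes> p = (p \<otimes> c \<otimes> p)\<^sup>\<star>" "p \<otimes> c\<^sup>\<star> = (c \<otimes> p)\<^sup>\<star>"
    using c pD by (simp_all add: star_mult m_assoc)
  then have "p \<otimes> c\<^sup>\<star> \<otimes> p = p \<otimes> c\<^sup>\<star> \<longleftrightarrow> p \<otimes> c \<otimes> p = c \<otimes> p"
    using c pD(1) by (metis star_star m_closed)
  moreover have "p \<otimes> c = p \<otimes> b"
    using m_assoc[of p "rp b" b] p(2) b pD eD by (simp add: c_def)
  ultimately show ?thesis
    by (simp add: c_def)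
qed

lemmas stable_iff = square_eq_mult_right square_eq_mult_left star_stable_iff

lemma lsquare_interval:
  assumes b: "b \<in> carrier A"
  shows "{a \<in> carrier A. right_star_lsquare_le A a b} = (\<otimes>) b ` stable_projections A (rp b) {b}"
proof -
  have "{a \<in> carrier A. right_star_lsquare_le A a b}
      = {a \<in> (\<otimes>) b ` stable_projections A (rp b) {}. a \<otimes> a = a \<otimes> b}"
    unfolding right_star_interval[OF b, symmetric] by (auto simp: right_star_lsquare_le_def)
  also have "\<dots> = (\<otimes>) b ` stable_projections A (rp b) {b}"
    using b by (auto simp: stable_projections_def stable_iff)
  finally show ?thesis .
qed

lemma rsquare_interval:
  assumes b: "b \<in> carrier A"
  shows "{a \<in> carrier A. right_star_rsquare_le A a b}
    = (\<otimes>) b ` stable_projections A (rp b) {(rp b \<otimes> b)\<^sup>\<star>}"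
proof -
  have "{a \<in> carrier A. right_star_rsquare_le A a b}
      = {a \<in> (\<otimes>) b ` stable_projections A (rp b) {}. a \<otimes> a = b \<otimes> a}"
    unfolding right_star_interval[OF b, symmetric] by (auto simp: right_star_rsquare_le_def)
  also have "\<dots> = (\<otimes>) b ` stable_projections A (rp b) {(rp b \<otimes> b)\<^sup>\<star>}"
    using b by (auto simp: stable_projections_def stable_iff)
  finally show ?thesis .
qed

lemma square_interval:
  assumes b: "b \<in> carrier A"
  shows "{a \<in> carrier A. right_star_square_le A a b}
    = (\<otimes>) b ` stable_projections A (rp b) {b, (rp b \<otimes> b)\<^sup>\<star>}"
proof -
  have "{a \<in> carrier A. right_star_square_le A a b}
      = {a \<in> (\<otimes>) b ` stable_projections A (rp b) {}. a \<otimes> a = a \<otimes> b \<and> a \<otimes> a = b \<otimes> a}"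
    unfolding right_star_interval[OF b, symmetric] by (auto simp: right_star_square_le_def)
  also have "\<dots> = (\<otimes>) b ` {p \<in> stable_projections A (rp b) {}.
      b \<otimes> p \<otimes> (b \<otimes> p) = b \<otimes> p \<otimes> b \<and> b \<otimes> p \<otimes> (b \<otimes> p) = b \<otimes> (b \<otimes> p)}"
    by blast
  also have "{p \<in> stable_projections A (rp b) {}.
      b \<otimes> p \<otimes> (b \<otimes> p) = b \<otimes> p \<otimes> b \<and> b \<otimes> p \<otimes> (b \<otimes> p) = b \<otimes> (b \<otimes> p)}
      = stable_projections A (rp b) {b, (rp b \<otimes> b)\<^sup>\<star>}"
    unfolding stable_projections_def using stable_iff[OF b] by blast
  finally show ?thesis .
qed

text \<open>Within the interval the square condition between two elements is automatic:
  \<open>p b\<close> ends in \<open>p\<close>, which absorbs \<open>q\<close>, so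
  \<open>p b q = p b p\<close>.\<close>

lemma lsquare_le_mult:
  assumes b: "b \<in> carrier A"
    and p: "p \<in> stable_projections A (rp b) {b}" and q: "q \<in> stable_projections A (rp b) {b}"
  shows "right_star_lsquare_le A (b \<otimes> p) (b \<otimes> q) \<longleftrightarrow> p \<otimes> q = p"
proof -
  have P: "projection A p" "p \<otimes> rp b = p" "p \<otimes> b \<otimes> p = p \<otimes> b"
    and Q: "projection A q" "q \<otimes> rp b = q"
    using p q by (auto simp: stable_projections_def)
  note pD = projectionD[OF P(1)] and qD = projectionD[OF Q(1)]
  have "b \<otimes> p \<otimes> (b \<otimes> p) = b \<otimes> p \<otimes> (b \<otimes> q)" if pq: "p \<otimes> q = p"
  proof -
    have "p \<otimes> b \<otimes> q = p \<otimes> b \<otimes> p \<otimes> q"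
      using P(3) by simp
    also have "\<dots> = p \<otimes> b \<otimes> p"
      using pq b pD qD by (simp add: m_assoc)
    finally show ?thesis
      using b pD qD by (simp add: m_assoc)
  qed
  then show ?thesis
    using right_star_le_mult[OF b P(1,2) Q] by (auto simp: right_star_lsquare_le_def)
qed

text \<open>Again the square condition comes for free: as \<open>q p = p\<close>, both
  \<open>q b p\<close> and \<open>p b p\<close> equal \<open>rp b b p\<close>.\<close>

lemma rsquare_le_mult:
  assumes b: "b \<in> carrier A"
    and p: "p \<in> stable_projections A (rp b) {(rp b \<otimes> b)\<^sup>\<star>}"
    and q: "q \<in> stable_projections A (rp b) {(rp b \<otimes> b)\<^sup>\<star>}"
  shows "right_star_rsquare_le A (b \<otimes> p) (b \<otimes> q) \<longleftrightarrow> p \<otimes> q = p"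
proof -
  have P: "projection A p" "p \<otimes> rp b = p" "p \<otimes> b \<otimes> p = rp b \<otimes> b \<otimes> p"
    and Q: "projection A q" "q \<otimes> rp b = q" "q \<otimes> b \<otimes> q = rp b \<otimes> b \<otimes> q"
    using p q b by (auto simp: stable_projections_def star_stable_iff)
  note pD = projectionD[OF P(1)] and qD = projectionD[OF Q(1)]
    and eD = projectionD[OF projection_rp[OF b]]
  have "b \<otimes> p \<otimes> (b \<otimes> p) = b \<otimes> q \<otimes> (b \<otimes> p)" if "p \<otimes> q = p"
  proof -
    have qp: "q \<otimes> p = p"
      using that projection_le_sym[OF P(1) Q(1)] by simp
    then have "q \<otimes> b \<otimes> p = q \<otimes> b \<otimes> q \<otimes> p"
      using b pD qD by (simp add: m_assoc)
    also have "\<dots> = rp b \<otimes> b \<otimes> (q \<otimes> p)"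
      using Q(3) b pD qD eD by (simp add: m_assoc)
    finally have "q \<otimes> b \<otimes> p = p \<otimes> b \<otimes> p"
      using P(3) qp by simp
    then show ?thesis
      using b pD qD by (simp add: m_assoc)
  qed
  then show ?thesis
    using right_star_le_mult[OF b P(1,2) Q(1,2)] by (auto simp: right_star_rsquare_le_def)
qed

end

theorem theorem38:
  fixes A :: "('a, 'm) star_ring_scheme" and b :: 'a
  assumes "regular_rickart_star_ring A"
    and "b \<in> carrier A"
  shows "sublattice (carrier (initial_interval A right_star_lsquare_le b))
           (initial_interval A right_star_le b)
         \<and> sublattice (carrier (initial_interval A right_star_rsquare_le b))
           (initial_interval A right_star_le b)
         \<and> sublattice (carrier (initial_interval A right_star_square_le b))
           (initial_interval A right_star_le b)
         \<and> sublattice (carrier (initial_interval A right_star_square_le b))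
           (initial_interval A right_star_lsquare_le b)
         \<and> sublattice (carrier (initial_interval A right_star_square_le b))
           (initial_interval A right_star_rsquare_le b)"
proof -
  interpret regular_rickart_star_ring A by fact
  note b = \<open>b \<in> carrier A\<close>
  define c where "c = (rp\<^bsub>A\<^esub> b \<otimes>\<^bsub>A\<^esub> b)\<^sup>\<star>\<^bsub>A\<^esub>"
  have c: "c \<in> carrier A"
    using b projectionD(1)[OF projection_rp[OF b]] by (simp add: c_def)
  note interval = right_star_interval[OF b] lsquare_interval[OF b, folded c_def]
    rsquare_interval[OF b, folded c_def] square_interval[OF b, folded c_def]
  have le: "right_star_le A (b \<otimes>\<^bsub>A\<^esub> p) (b \<otimes>\<^bsub>A\<^esub> q) \<longleftrightarrow> p \<otimes>\<^bsub>A\<^esub> q = p"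
    if "p \<in> stable_projections A (rp\<^bsub>A\<^esub> b) {}" "q \<in> stable_projections A (rp\<^bsub>A\<^esub> b) {}" for p q
    using that right_star_le_mult[OF b] by (simp add: stable_projections_def)
  note les = le lsquare_le_mult[OF b] rsquare_le_mult[OF b, folded c_def]
  show ?thesis
  \<comment> \<open>Each claim is an instance with \<open>D\<close> contained in \<open>C\<close>:
    \<open>b\<close> encodes \<open>a a = a b\<close>, and \<open>c\<close> encodes
    \<open>a a = b a\<close>.\<close>
  proof (intro conjI)
    show "sublattice (carrier (initial_interval A right_star_lsquare_le b))
        (initial_interval A right_star_le b)"
      by (rule sublattice_image[OF b, where C = "{b}" and D = "{}"])
        (use b c in \<open>simp_all add: initial_interval_def interval les\<close>)
    show "sublattice (carrier (initial_interval A right_star_rsquare_le b))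
        (initial_interval A right_star_le b)"
      by (rule sublattice_image[OF b, where C = "{c}" and D = "{}"])
        (use b c in \<open>simp_all add: initial_interval_def interval les\<close>)
    show "sublattice (carrier (initial_interval A right_star_square_le b))
        (initial_interval A right_star_le b)"
      by (rule sublattice_image[OF b, where C = "{b, c}" and D = "{}"])
        (use b c in \<open>simp_all add: initial_interval_def interval les\<close>)
    show "sublattice (carrier (initial_interval A right_star_square_le b))
        (initial_interval A right_star_lsquare_le b)"
      by (rule sublattice_image[OF b, where C = "{b, c}" and D = "{b}"])
        (use b c in \<open>simp_all add: initial_interval_def interval les\<close>)
    show "sublattice (carrier (initial_interval A right_star_square_le b))
        (initial_interval A right_star_rsquare_le b)"
      by (rule sublattice_image[OF b, where C = "{b, c}" and D = "{c}"])
        (use b c in \<open>simp_all add: initial_interval_def interval les\<close>)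
  qed
qed

end
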